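(* Let $\mathcal{H}$ be a Hilbert space over $\mathbb{K}\in\{\mathbb{R},\mathbb{C}\}$ of finite dimension $d$, let $(\Omega,\mu)$ be a measure space, and let $\{\tau_\alpha\}_{\alpha\in\Omega}$ be a normalized continuous Bessel family for $\mathcal{H}$. Suppose that the diagonal $\Delta:=\{(\alpha,\alpha):\alpha\in\Omega\}$ is measurable in $\Omega\times\Omega$. Then $$1\ \ge\ I_{\mathrm{CRMS}}(\{\tau_\alpha\}_{\alpha\in\Omega})\ \ge\ \left(\frac{1}{(\mu\times\mu)((\Omega\times\Omega)\setminus\Delta)}\left[\frac{\mu(\Omega)^2}{d}-(\mu\times\mu)(\Delta)\right]\right)^{1/2}.$$
   Context: A collection $\{\tau_\alpha\}_{\alpha\in\Omega}$ in a finite-dimensional Hilbert space $\mathcal{H}$ over $\mathbb{K}$ is a continuous Bessel family for $\mathcal{H}$ if (i) for each $h\in\mathcal{H}$ the map $\Omega\ni\alpha\mapsto\langle h,\tau_\alpha\rangle\in\mathbb{K}$ is measurable, and (ii) there is $b>0$ with $\int_\Omega|\langle h,\tau_\alpha\rangle|^2\,d\mu(\alpha)\le b\|h\|^2$ for all $h\in\mathcal{H}$. It is normalized if $\|\tau_\alpha\|=1$ for all $\alpha\in\Omega$. $\mu\times\mu$ is the product measure on $\Omega\times\Omega$. For a normalized continuous Bessel family with measurable diagonal $\Delta$, the continuous root-mean-square absolute cross relation is $$I_{\mathrm{CRMS}}(\{\tau_\alpha\}_{\alpha\in\Omega}):=\left(\frac{1}{(\mu\times\mu)((\Omega\times\Omega)\setminus\Delta)}\int_{(\Omega\times\Omega)\setminus\Delta}|\langle\tau_\alpha,\tau_\beta\rangle|^2\,d(\mu\times\mu)(\alpha,\beta)\right)^{1/2}.$$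 *)

theory Defs
  imports "HOL-Analysis.Analysis"
begin

text \<open>The scalar fields \<open>\<real>\<close> and \<open>\<complex>\<close>, treated uniformly: a field embedded isometrically in
  \<open>\<complex>\<close>, with image either the real line or all of \<open>\<complex>\<close>. Conjugation on the scalars is
  conjugation of the image.\<close>

class real_or_complex = real_normed_field +
  fixes to_complex :: "'a \<Rightarrow> complex"
  assumes to_complex_add: "to_complex (x + y) = to_complex x + to_complex y"
    and to_complex_mult: "to_complex (x * y) = to_complex x * to_complex y"
    and to_complex_scaleR_one: "to_complex (r *\<^sub>R 1) = complex_of_real r"
    and norm_to_complex: "norm (to_complex x) = norm x"
    and range_to_complex: "range to_complex = \<real> \<or> range to_complex = UNIV"

instantiation real :: real_or_complex
begin

definition to_complex_real :: "real \<Rightarrow> complex" where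
  "to_complex_real = complex_of_real"

instance
  by standard (auto simp: to_complex_real_def Reals_def)

end

instantiation complex :: real_or_complex
begin

definition to_complex_complex :: "complex \<Rightarrow> complex" where
  "to_complex_complex = (\<lambda>z. z)"

instance
  by standard (auto simp: to_complex_complex_def scaleR_conv_of_real)

end

text \<open>A Hilbert space over \<open>'k\<close> is a Banach space over \<open>'k\<close> whose norm comes from an inner product
  (linear in the first argument). Positive definiteness of the inner product is contained in
  \<open>ip_self\<close>.\<close>

locale hilbert_space = vector_space scale
  for scale :: "'k::real_or_complex \<Rightarrow> 'h::banach \<Rightarrow> 'h" +
  fixes ip :: "'h \<Rightarrow> 'h \<Rightarrow> 'k"
  assumes scale_of_real: "scale (of_real r) x = r *\<^sub>R x"
    and ip_add_left: "ip (x + y) z = ip x z + ip y z"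
    and ip_scale_left: "ip (scale c x) y = c * ip x y"
    and ip_hermitian: "to_complex (ip y x) = cnj (to_complex (ip x y))"
    and ip_self: "ip x x = of_real ((norm x)\<^sup>2)"

text \<open>Finite dimensionality is a separate requirement because the library's \<open>dim\<close> is \<open>0\<close> on
  infinite-dimensional spaces.\<close>

locale finite_dim_hilbert_space = hilbert_space +
  assumes finite_spanning_set: "\<exists>B. finite B \<and> span B = UNIV"

text \<open>The Bessel bound uses the nonnegative integral, so that it does include finiteness of the
  left-hand side.\<close>

definition continuous_Bessel_family ::
  "('h::real_normed_vector \<Rightarrow> 'h \<Rightarrow> 'k::real_normed_field) \<Rightarrow> 'a measure \<Rightarrow> ('a \<Rightarrow> 'h) \<Rightarrow> bool" where
  "continuous_Bessel_family ip M \<tau> \<longleftrightarrow>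
     (\<forall>h. (\<lambda>\<alpha>. ip h (\<tau> \<alpha>)) \<in> borel_measurable M) \<and>
     (\<exists>b>0. \<forall>h. (\<integral>\<^sup>+\<alpha>. ennreal ((norm (ip h (\<tau> \<alpha>)))\<^sup>2) \<partial>M) \<le> ennreal (b * (norm h)\<^sup>2))"

definition normalized_family :: "'a measure \<Rightarrow> ('a \<Rightarrow> 'h::real_normed_vector) \<Rightarrow> bool" where
  "normalized_family M \<tau> \<longleftrightarrow> (\<forall>\<alpha>\<in>space M. norm (\<tau> \<alpha>) = 1)"

definition diagonal :: "'a measure \<Rightarrow> ('a \<times> 'a) set" where
  "diagonal M = {(\<alpha>, \<alpha>) | \<alpha>. \<alpha> \<in> space M}"

definition off_diagonal :: "'a measure \<Rightarrow> ('a \<times> 'a) set" where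
  "off_diagonal M = (space M \<times> space M) - diagonal M"

text \<open>A normalized continuous Bessel family in a finite-dimensional space forces \<open>M\<close> to be a
  finite measure (sum the Bessel bound over an orthonormal basis). Hence \<open>M \<Otimes>\<^sub>M M\<close> is the usual
  product measure, and the real-valued \<open>measure\<close> and the Bochner integral of the bounded integrand
  below lose nothing. If the off-diagonal part is a null set, the value is \<open>0\<close>.
  Note that \<open>sqrt\<close> is negative on negative arguments, so that a lower bound \<open>sqrt c \<le> I_CRMS ip M \<tau>\<close>
  says nothing when \<open>c < 0\<close>.\<close>

definition I_CRMS ::
  "('h \<Rightarrow> 'h \<Rightarrow> 'k::real_normed_field) \<Rightarrow> 'a measure \<Rightarrow> ('a \<Rightarrow> 'h) \<Rightarrow> real" where
  "I_CRMS ip M \<tau> =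
     sqrt (1 / measure (M \<Otimes>\<^sub>M M) (off_diagonal M) *
       (LINT (\<alpha>, \<beta>) : off_diagonal M | M \<Otimes>\<^sub>M M. (norm (ip (\<tau> \<alpha>) (\<tau> \<beta>)))\<^sup>2))"

end

theory Submission
  imports Defs
begin

text \<open>In coordinates with respect to an orthonormal basis \<open>e\<^sub>1, \<dots>, e\<^sub>d\<close>, let \<open>G\<close> be the
  \<open>d \<times> d\<close> matrix of the frame operator, \<open>G\<^sub>i\<^sub>j = \<integral> \<langle>e\<^sub>i, \<tau>\<^sub>\<alpha>\<rangle> \<langle>\<tau>\<^sub>\<alpha>, e\<^sub>j\<rangle> d\<mu>(\<alpha>)\<close>. By Fubini, the
  integral of \<open>|\<langle>\<tau>\<^sub>\<alpha>, \<tau>\<^sub>\<beta>\<rangle>|\<^sup>2\<close> over the whole of \<open>\<Omega> \<times> \<Omega>\<close> is the squared Hilbert-Schmidt norm of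
  \<open>G\<close>. Discarding the off-diagonal entries of \<open>G\<close> and applying Cauchy-Schwarz to the \<open>d\<close> diagonal
  ones bounds this from below by \<open>(tr G)\<^sup>2 / d\<close>. As each \<open>\<tau>\<^sub>\<alpha>\<close> is a unit vector, the trace is
  \<open>\<mu>(\<Omega>)\<close>. This is \<open>double_integral_gram_ge\<close>.

  On the diagonal the integrand is \<open>1\<close>, so restricting the integral to the complement of \<open>\<Delta>\<close>
  subtracts exactly \<open>(\<mu> \<times> \<mu>)(\<Delta>)\<close>; this gives the lower bound. The upper bound is the
  Cauchy-Schwarz inequality \<open>|\<langle>\<tau>\<^sub>\<alpha>, \<tau>\<^sub>\<beta>\<rangle>| \<le> 1\<close>.

  All of this needs \<open>\<mu>\<close> to be finite. Summing the Bessel inequality over the basis bounds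
  \<open>\<mu>(\<Omega>) = \<integral> \<Sum>\<^sub>i |\<langle>e\<^sub>i, \<tau>\<^sub>\<alpha>\<rangle>|\<^sup>2 d\<mu>(\<alpha>)\<close> (\<open>finite_measure_if_normalized_Bessel\<close>).\<close>

section \<open>The embedding of the scalars into the complex numbers\<close>

lemma to_complex_of_real: "to_complex (of_real r :: 'k::real_or_complex) = complex_of_real r"
  using to_complex_scaleR_one[where 'a = 'k] by (simp add: of_real_def)

lemma to_complex_0: "to_complex (0 :: 'k::real_or_complex) = 0"
  using to_complex_of_real[of 0, where 'k = 'k] by simp

lemma to_complex_minus: "to_complex (- x :: 'k::real_or_complex) = - to_complex x"
  using to_complex_add[of x "- x"] by (simp add: to_complex_0 eq_neg_iff_add_eq_0 add.commute)

lemma to_complex_diff: "to_complex (x - y :: 'k::real_or_complex) = to_complex x - to_complex y"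
  using to_complex_add[of x "- y"] by (simp add: to_complex_minus)

lemma to_complex_sum:
  "to_complex (sum f A) = (\<Sum>i\<in>A. to_complex (f i :: 'k::real_or_complex))"
  by (induction A rule: infinite_finite_induct) (simp_all add: to_complex_0 to_complex_add)

lemma to_complex_eq_0_iff: "to_complex (x :: 'k::real_or_complex) = 0 \<longleftrightarrow> x = 0"
  by (metis norm_eq_zero norm_to_complex)

lemma continuous_on_to_complex: "continuous_on S (to_complex :: 'k::real_or_complex \<Rightarrow> complex)"
  unfolding continuous_on_iff dist_norm
  by (metis norm_to_complex to_complex_diff)

section \<open>Orthonormal bases over either scalar field\<close>

context hilbert_space
begin

lemma ip_diff_left: "ip (x - y) z = ip x z - ip y z"
  using ip_add_left[of "x - y" y z] by simp

lemma ip_zero_left: "ip 0 z = 0"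
  using ip_diff_left[of 0 0 z] by simp

lemma ip_sum_left: "ip (sum f A) z = (\<Sum>i\<in>A. ip (f i) z)"
  by (induction A rule: infinite_finite_induct) (simp_all add: ip_zero_left ip_add_left)

lemma ip_eq_0_commute: "ip x y = 0 \<longleftrightarrow> ip y x = 0"
  by (metis complex_cnj_zero_iff ip_hermitian to_complex_eq_0_iff)

lemma ip_self_eq_0_iff: "ip x x = 0 \<longleftrightarrow> x = 0"
  by (simp add: ip_self)

definition orthonormal :: "'h set \<Rightarrow> bool" where
  "orthonormal E \<longleftrightarrow> (\<forall>e\<in>E. \<forall>f\<in>E. ip e f = (if e = f then 1 else 0))"

lemma ip_orthonormal_sum:
  assumes "finite E" "orthonormal E" "e \<in> E"
  shows "ip (\<Sum>f\<in>E. scale (u f) f) e = u e"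
proof -
  have "ip (\<Sum>f\<in>E. scale (u f) f) e = (\<Sum>f\<in>E. if f = e then u f else 0)"
    unfolding ip_sum_left ip_scale_left
    using assms by (intro sum.cong) (auto simp: orthonormal_def)
  then show ?thesis using assms by simp
qed

lemma independent_if_orthonormal:
  assumes "finite E" "orthonormal E"
  shows "independent E"
  using assms by (intro independent_if_scalars_zero) (metis ip_orthonormal_sum ip_zero_left)+

text \<open>The residual is orthogonal to \<open>E\<close>, hence to \<open>span E\<close>, which contains it.\<close>

lemma orthonormal_expansion:
  assumes E: "finite E" "orthonormal E" and x: "x \<in> span E"
  shows "x = (\<Sum>e\<in>E. scale (ip x e) e)"
proof -
  let ?y = "x - (\<Sum>e\<in>E. scale (ip x e) e)"
  have "ip z ?y = 0" if "z \<in> span E" for z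
    using that
  proof (induction rule: span_induct)
    case base
    show ?case
      by (rule subspaceI) (auto simp: ip_zero_left ip_add_left ip_scale_left)
  next
    case (step e)
    then have "ip ?y e = 0" using ip_orthonormal_sum[OF E] by (simp add: ip_diff_left)
    then show ?case using ip_eq_0_commute by blast
  qed
  moreover have "?y \<in> span E"
    by (intro span_diff x span_sum span_scale) (rule span_base)
  ultimately have "?y = 0" using ip_self_eq_0_iff by blast
  then show ?thesis by simp
qed

text \<open>One Gram-Schmidt step for each vector of \<open>B\<close>.\<close>

lemma exists_orthonormal_same_span:
  assumes "finite B"
  shows "\<exists>E. finite E \<and> orthonormal E \<and> span E = span B"
  using assms
proof (induction B rule: finite_induct)
  case empty
  then show ?case by (intro exI[of _ "{}"]) (auto simp: orthonormal_def)
next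
  case (insert x B)
  then obtain E where E: "finite E" "orthonormal E" "span E = span B" by blast
  define p where "p = (\<Sum>e\<in>E. scale (ip x e) e)"
  define y where "y = x - p"
  have p: "p \<in> span E" unfolding p_def by (intro span_sum span_scale span_base)
  have ortho: "ip y e = 0" if "e \<in> E" for e
    using ip_orthonormal_sum[OF E(1,2) that] by (simp add: y_def p_def ip_diff_left)
  have span_y: "span (insert x B) = span (insert y E)"
  proof -
    have "span (insert x E) = span (insert y E)"
      by (intro eq_span_insert_eq) (simp add: y_def p)
    moreover have "span (insert x B) = span (insert x E)"
      unfolding span_insert by (simp add: E(3))
    ultimately show ?thesis by simp
  qed
  show ?case
  proof (cases "y = 0")
    case True
    then show ?thesis using E span_y by auto
  next
    case False
    define c :: 'k where "c = of_real (inverse (norm y))"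
    let ?z = "scale c y"
    have c: "c \<noteq> 0" using False by (simp add: c_def)
    have "norm ?z = 1" using False unfolding c_def scale_of_real by simp
    then have "ip ?z ?z = 1" by (simp add: ip_self)
    moreover have "ip ?z e = 0" "ip e ?z = 0" if "e \<in> E" for e
      using ortho[OF that] ip_eq_0_commute[of e ?z] by (simp_all add: ip_scale_left)
    ultimately have "orthonormal (insert ?z E)"
      using E(2) unfolding orthonormal_def by (metis insert_iff zero_neq_one)
    moreover have "span (insert ?z E) = span (insert y E)"
    proof (intro span_eq[THEN iffD2] conjI subsetI)
      fix v assume "v \<in> insert ?z E"
      then show "v \<in> span (insert y E)" by (auto intro: span_scale span_base)
    next
      fix v assume v: "v \<in> insert y E"
      have "y = scale (inverse c) ?z" using c by simp
      then have "y \<in> span (insert ?z E)" by (metis insertI1 span_base span_scale)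
      then show "v \<in> span (insert ?z E)" using v by (auto intro: span_base)
    qed
    ultimately show ?thesis using E(1) span_y by (intro exI[of _ "insert ?z E"]) auto
  qed
qed

text \<open>Parseval's identity. It is stated after embedding the scalars into \<open>\<complex>\<close>, where conjugation
  and the Lebesgue integral of scalar functions are available for both scalar fields.\<close>

lemma to_complex_ip_coordinates:
  assumes "finite E" "orthonormal E" "span E = UNIV"
  shows "to_complex (ip x y) = (\<Sum>e\<in>E. cnj (to_complex (ip e x)) * to_complex (ip e y))"
proof -
  have "ip x y = (\<Sum>e\<in>E. ip x e * ip e y)"
    using arg_cong[OF orthonormal_expansion[OF assms(1,2), of x], of "\<lambda>z. ip z y"] assms(3)
    by (simp add: ip_sum_left ip_scale_left)
  then show ?thesis
    by (simp add: to_complex_sum to_complex_mult flip: ip_hermitian)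
qed

lemma norm_square_coordinates:
  assumes "finite E" "orthonormal E" "span E = UNIV"
  shows "(norm x)\<^sup>2 = (\<Sum>e\<in>E. (norm (ip e x))\<^sup>2)"
proof -
  have square: "complex_of_real ((norm c)\<^sup>2) = cnj (to_complex c) * to_complex c" for c :: 'k
    by (metis complex_norm_square mult.commute norm_to_complex)
  have "complex_of_real ((norm x)\<^sup>2) = to_complex (ip x x)"
    by (simp only: ip_self to_complex_of_real)
  also have "\<dots> = complex_of_real (\<Sum>e\<in>E. (norm (ip e x))\<^sup>2)"
    unfolding to_complex_ip_coordinates[OF assms, of x x] of_real_sum square ..
  finally show ?thesis by (simp only: of_real_eq_iff)
qed

lemma Cauchy_Schwarz_ip:
  assumes E: "finite E" "orthonormal E" "span E = UNIV"
  shows "norm (ip x y) \<le> norm x * norm y"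
proof -
  have "norm (ip x y) \<le> (\<Sum>e\<in>E. \<bar>norm (ip e x)\<bar> * \<bar>norm (ip e y)\<bar>)"
    unfolding norm_to_complex[symmetric, of "ip x y"] to_complex_ip_coordinates[OF E, of x y]
    by (rule order_trans[OF norm_sum]) (simp add: norm_mult norm_to_complex)
  also have "\<dots> \<le> L2_set (\<lambda>e. norm (ip e x)) E * L2_set (\<lambda>e. norm (ip e y)) E"
    by (rule L2_set_mult_ineq)
  also have "\<dots> = norm x * norm y"
    by (simp add: L2_set_def flip: norm_square_coordinates[OF E, of x] norm_square_coordinates[OF E, of y])
  finally show ?thesis .
qed

text \<open>Over an orthonormal basis the Bessel integrands sum to \<open>\<parallel>\<tau>\<^sub>\<alpha>\<parallel>\<^sup>2 = 1\<close>.\<close>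

lemma finite_measure_if_normalized_Bessel:
  assumes E: "finite E" "orthonormal E" "span E = UNIV"
    and bessel: "continuous_Bessel_family ip M \<tau>" and unit: "normalized_family M \<tau>"
  shows "finite_measure M"
proof (rule finite_measureI)
  obtain b where b: "\<And>h. (\<integral>\<^sup>+\<alpha>. ennreal ((norm (ip h (\<tau> \<alpha>)))\<^sup>2) \<partial>M) \<le> ennreal (b * (norm h)\<^sup>2)"
    using bessel unfolding continuous_Bessel_family_def by blast
  have [measurable]: "(\<lambda>\<alpha>. ip h (\<tau> \<alpha>)) \<in> borel_measurable M" for h
    using bessel unfolding continuous_Bessel_family_def by blast
  have "emeasure M (space M) = (\<integral>\<^sup>+\<alpha>. 1 \<partial>M)" by simp
  also have "\<dots> = (\<integral>\<^sup>+\<alpha>. (\<Sum>e\<in>E. ennreal ((norm (ip e (\<tau> \<alpha>)))\<^sup>2)) \<partial>M)"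
  proof (rule nn_integral_cong)
    fix \<alpha> assume "\<alpha> \<in> space M"
    then have "(\<Sum>e\<in>E. (norm (ip e (\<tau> \<alpha>)))\<^sup>2) = 1"
      using unit norm_square_coordinates[OF E, of "\<tau> \<alpha>"] by (simp add: normalized_family_def)
    then show "1 = (\<Sum>e\<in>E. ennreal ((norm (ip e (\<tau> \<alpha>)))\<^sup>2))"
      by (simp add: sum_ennreal)
  qed
  also have "\<dots> = (\<Sum>e\<in>E. \<integral>\<^sup>+\<alpha>. ennreal ((norm (ip e (\<tau> \<alpha>)))\<^sup>2) \<partial>M)"
    by (intro nn_integral_sum) measurable
  also have "\<dots> \<le> (\<Sum>e\<in>E. ennreal (b * (norm e)\<^sup>2))"
    by (intro sum_mono b)
  also have "\<dots> < \<infinity>" using E(1) by simp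
  finally show "emeasure M (space M) \<noteq> \<infinity>" by simp
qed

end

section \<open>The double integral of a squared Gram kernel\<close>

lemma (in pair_sigma_finite)
  fixes f :: "'a \<Rightarrow> 'c::{real_normed_field, banach, second_countable_topology}"
  assumes f: "integrable M1 f" and g: "integrable M2 g"
  shows integrable_mult_pair: "integrable (M1 \<Otimes>\<^sub>M M2) (\<lambda>(x, y). f x * g y)" 
    and integral_mult_pair:
      "(\<integral>(x, y). f x * g y \<partial>(M1 \<Otimes>\<^sub>M M2)) = (\<integral>x. f x \<partial>M1) * (\<integral>y. g y \<partial>M2)"
proof -
  have [measurable]: "f \<in> borel_measurable M1" "g \<in> borel_measurable M2"
    using f g by auto
  show "integrable (M1 \<Otimes>\<^sub>M M2) (\<lambda>(x, y). f x * g y)"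
  proof (rule Fubini_integrable)
    show "integrable M1 (\<lambda>x. \<integral>y. norm (case (x, y) of (x, y) \<Rightarrow> f x * g y) \<partial>M2)"
      using f by (simp add: norm_mult)
    show "AE x in M1. integrable M2 (\<lambda>y. case (x, y) of (x, y) \<Rightarrow> f x * g y)"
      using g by simp
  qed measurable
  then have "(\<integral>(x, y). f x * g y \<partial>(M1 \<Otimes>\<^sub>M M2)) = (\<integral>x. \<integral>y. f x * g y \<partial>M2 \<partial>M1)"
    by (rule integral_fst[symmetric])
  then show "(\<integral>(x, y). f x * g y \<partial>(M1 \<Otimes>\<^sub>M M2)) = (\<integral>x. f x \<partial>M1) * (\<integral>y. g y \<partial>M2)"
    by simp
qed

text \<open>The bound \<open>\<parallel>G\<parallel>\<^sub>H\<^sub>S\<^sup>2 \<ge> (tr G)\<^sup>2 / d\<close> for the matrix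
  \<open>G\<^sub>i\<^sub>j = \<integral> x\<^sub>i cnj x\<^sub>j d\<mu>\<close> of a family of unit vectors with coordinates \<open>x\<^sub>i\<close>.\<close>

lemma double_integral_gram_ge:
  fixes x :: "'i \<Rightarrow> 'a \<Rightarrow> complex"
  assumes M: "finite_measure M" and I: "finite I"
    and meas: "\<And>i. i \<in> I \<Longrightarrow> x i \<in> borel_measurable M"
    and unit: "\<And>\<alpha>. \<alpha> \<in> space M \<Longrightarrow> (\<Sum>i\<in>I. (cmod (x i \<alpha>))\<^sup>2) = 1"
  shows "(measure M (space M))\<^sup>2 / card I
    \<le> (\<integral>(\<alpha>, \<beta>). (cmod (\<Sum>i\<in>I. cnj (x i \<alpha>) * x i \<beta>))\<^sup>2 \<partial>(M \<Otimes>\<^sub>M M))"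
proof -
  interpret finite_measure M by fact
  interpret P: pair_sigma_finite M M ..
  define G where "G i j = (\<integral>\<alpha>. x i \<alpha> * cnj (x j \<alpha>) \<partial>M)" for i j
  have bound: "cmod (x i \<alpha>) \<le> 1" if "i \<in> I" "\<alpha> \<in> space M" for i \<alpha>
  proof -
    have "(cmod (x i \<alpha>))\<^sup>2 \<le> (\<Sum>i\<in>I. (cmod (x i \<alpha>))\<^sup>2)"
      using that I by (intro member_le_sum) auto
    then show ?thesis using unit[OF that(2)] by (simp add: abs_square_le_1)
  qed
  have int: "integrable M (\<lambda>\<alpha>. x i \<alpha> * cnj (x j \<alpha>))" if "i \<in> I" "j \<in> I" for i j
  proof (rule integrable_const_bound[where B = 1])
    show "AE \<alpha> in M. norm (x i \<alpha> * cnj (x j \<alpha>)) \<le> 1"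
      using bound that by (intro AE_I2) (simp add: norm_mult mult_le_one)
    show "(\<lambda>\<alpha>. x i \<alpha> * cnj (x j \<alpha>)) \<in> borel_measurable M"
      using meas that by (intro borel_measurable_times borel_measurable_continuous_on[where f = cnj])
        (auto intro: continuous_intros)
  qed
  have integrable_pair: "integrable (M \<Otimes>\<^sub>M M)
      (\<lambda>p. (x j (fst p) * cnj (x i (fst p))) * (x i (snd p) * cnj (x j (snd p))))"
    if "i \<in> I" "j \<in> I" for i j
    using P.integrable_mult_pair[OF int int, of j i i j] that by (simp add: case_prod_unfold)
  have G_square: "G j i * G i j = complex_of_real ((cmod (G i j))\<^sup>2)" for i j
  proof -
    have "G j i = cnj (G i j)"
      unfolding G_def Bochner_Integration.integral_cnj[symmetric] complex_cnj_mult complex_cnj_cnj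
      by (simp only: mult.commute)
    then show ?thesis by (simp only: complex_norm_square mult.commute)
  qed
  \<comment> \<open>Expanding the square separates the variables: each term is a function of \<open>\<alpha>\<close> times a
    function of \<open>\<beta>\<close>, so that its double integral is a product of entries of \<open>G\<close>.\<close>
  have expand: "complex_of_real ((cmod (\<Sum>i\<in>I. cnj (x i \<alpha>) * x i \<beta>))\<^sup>2)
      = (\<Sum>i\<in>I. \<Sum>j\<in>I. (x j \<alpha> * cnj (x i \<alpha>)) * (x i \<beta> * cnj (x j \<beta>)))" for \<alpha> \<beta>
    unfolding complex_norm_square cnj_sum sum_product by (simp add: mult_ac)
  have "complex_of_real (\<integral>(\<alpha>, \<beta>). (cmod (\<Sum>i\<in>I. cnj (x i \<alpha>) * x i \<beta>))\<^sup>2 \<partial>(M \<Otimes>\<^sub>M M))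
      = (\<integral>p. (\<Sum>i\<in>I. \<Sum>j\<in>I. (x j (fst p) * cnj (x i (fst p))) * (x i (snd p) * cnj (x j (snd p))))
          \<partial>(M \<Otimes>\<^sub>M M))"
    unfolding expand[symmetric] case_prod_beta by (rule integral_complex_of_real[symmetric])
  also have "\<dots> = (\<Sum>i\<in>I. \<Sum>j\<in>I.
      \<integral>p. (x j (fst p) * cnj (x i (fst p))) * (x i (snd p) * cnj (x j (snd p))) \<partial>(M \<Otimes>\<^sub>M M))"
    by (simp add: integrable_pair)
  also have "\<dots> = (\<Sum>i\<in>I. \<Sum>j\<in>I. G j i * G i j)"
    unfolding G_def
    using P.integral_mult_pair[OF int int] by (intro sum.cong refl) (simp add: case_prod_unfold)
  also have "\<dots> = complex_of_real (\<Sum>i\<in>I. \<Sum>j\<in>I. (cmod (G i j))\<^sup>2)"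
    by (simp only: G_square of_real_sum)
  finally have integral_eq: "(\<integral>(\<alpha>, \<beta>). (cmod (\<Sum>i\<in>I. cnj (x i \<alpha>) * x i \<beta>))\<^sup>2 \<partial>(M \<Otimes>\<^sub>M M))
      = (\<Sum>i\<in>I. \<Sum>j\<in>I. (cmod (G i j))\<^sup>2)"
    by (simp only: of_real_eq_iff)
  have "complex_of_real (measure M (space M)) = (\<integral>\<alpha>. 1 \<partial>M)"
    by (simp add: scaleR_conv_of_real)
  also have "\<dots> = (\<integral>\<alpha>. (\<Sum>i\<in>I. x i \<alpha> * cnj (x i \<alpha>)) \<partial>M)"
    using unit by (intro Bochner_Integration.integral_cong refl)
      (simp flip: complex_norm_square of_real_power of_real_sum)
  also have "\<dots> = (\<Sum>i\<in>I. G i i)"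
    unfolding G_def by (intro Bochner_Integration.integral_sum int)
  finally have trace: "complex_of_real (measure M (space M)) = (\<Sum>i\<in>I. G i i)" .
  \<comment> \<open>Cauchy-Schwarz on the diagonal of \<open>G\<close>. For empty \<open>I\<close> the left-hand side of the claim is a
    division by \<open>0\<close>, hence \<open>0\<close>.\<close>
  have "measure M (space M) \<le> (\<Sum>i\<in>I. cmod (G i i))"
    using norm_sum[of "\<lambda>i. G i i" I] by (simp flip: trace)
  then have "(measure M (space M))\<^sup>2 \<le> (\<Sum>i\<in>I. cmod (G i i))\<^sup>2"
    by (intro power_mono) simp_all
  also have "\<dots> \<le> (\<Sum>i\<in>I. (cmod (G i i))\<^sup>2) * card I"
    by (rule sum_squared_le_sum_of_squares)
  finally have "(measure M (space M))\<^sup>2 / card I \<le> (\<Sum>i\<in>I. (cmod (G i i))\<^sup>2)"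
    by (cases "card I = 0") (simp_all add: sum_nonneg divide_le_eq)
  also have "\<dots> \<le> (\<Sum>i\<in>I. \<Sum>j\<in>I. (cmod (G i j))\<^sup>2)"
    using I by (intro sum_mono member_le_sum) auto
  finally show ?thesis unfolding integral_eq .
qed

section \<open>The bounds on the cross relation\<close>

theorem proposition3p2:
  fixes scale :: "'k::real_or_complex \<Rightarrow> 'h::banach \<Rightarrow> 'h"
    and ip :: "'h \<Rightarrow> 'h \<Rightarrow> 'k"
    and M :: "'a measure"
    and \<tau> :: "'a \<Rightarrow> 'h"
    and d :: nat
  assumes "finite_dim_hilbert_space scale ip"
    and "vector_space.dim scale (UNIV :: 'h set) = d"
    and "continuous_Bessel_family ip M \<tau>"
    and "normalized_family M \<tau>"
    and "diagonal M \<in> sets (M \<Otimes>\<^sub>M M)"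
  shows "1 \<ge> I_CRMS ip M \<tau> \<and>
    I_CRMS ip M \<tau> \<ge>
      sqrt (1 / measure (M \<Otimes>\<^sub>M M) (off_diagonal M) *
        ((measure M (space M))\<^sup>2 / real d - measure (M \<Otimes>\<^sub>M M) (diagonal M)))"
proof -
  interpret H: finite_dim_hilbert_space scale ip by fact
  obtain E where E: "finite E" "H.orthonormal E" "H.span E = UNIV"
    using H.finite_spanning_set H.exists_orthonormal_same_span by metis
  have d: "card E = d"
    using H.dim_eq_card[of E UNIV] H.independent_if_orthonormal[OF E(1,2)] E(3) assms(2) by simp
  have M: "finite_measure M"
    by (rule H.finite_measure_if_normalized_Bessel[OF E assms(3,4)])
  interpret MM: finite_measure "M \<Otimes>\<^sub>M M"
    using finite_measure_pair_measure[OF M M] .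
  define K where "K = (\<lambda>(\<alpha>, \<beta>). (norm (ip (\<tau> \<alpha>) (\<tau> \<beta>)))\<^sup>2)"
  define x where "x e \<alpha> = to_complex (ip e (\<tau> \<alpha>))" for e \<alpha>
  have unit: "norm (\<tau> \<alpha>) = 1" if "\<alpha> \<in> space M" for \<alpha>
    using assms(4) that by (simp add: normalized_family_def)
  have K_eq: "K = (\<lambda>(\<alpha>, \<beta>). (cmod (\<Sum>e\<in>E. cnj (x e \<alpha>) * x e \<beta>))\<^sup>2)"
    unfolding K_def x_def H.to_complex_ip_coordinates[OF E, symmetric] norm_to_complex ..
  have x_meas: "x e \<in> borel_measurable M" for e
    unfolding x_def using assms(3)
    by (intro borel_measurable_continuous_on[OF continuous_on_to_complex])
      (simp add: continuous_Bessel_family_def)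
  have x_unit: "(\<Sum>e\<in>E. (cmod (x e \<alpha>))\<^sup>2) = 1" if "\<alpha> \<in> space M" for \<alpha>
    using H.norm_square_coordinates[OF E, of "\<tau> \<alpha>"] unit[OF that]
    by (simp add: x_def norm_to_complex)
  have K_le: "K p \<le> 1" if "p \<in> space (M \<Otimes>\<^sub>M M)" for p
    using H.Cauchy_Schwarz_ip[OF E, of "\<tau> (fst p)" "\<tau> (snd p)"] unit that
    by (auto simp: K_def space_pair_measure power_le_one)
  have K_meas: "K \<in> borel_measurable (M \<Otimes>\<^sub>M M)"
  proof -
    note x_meas[measurable]
    have [measurable]: "cnj \<in> borel_measurable borel"
      by (intro borel_measurable_continuous_onI continuous_intros)
    show ?thesis unfolding K_eq by measurable
  qed
  have K_int: "integrable (M \<Otimes>\<^sub>M M) K"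
    using K_le by (intro MM.integrable_const_bound[where B = 1] AE_I2 K_meas)
      (auto simp: K_def)
  have off: "off_diagonal M = space (M \<Otimes>\<^sub>M M) - diagonal M"
    by (simp add: off_diagonal_def space_pair_measure)
  have off_sets: "off_diagonal M \<in> sets (M \<Otimes>\<^sub>M M)"
    unfolding off using assms(5) by (rule sets.compl_sets)
  define J where "J = (LINT p : off_diagonal M | M \<Otimes>\<^sub>M M. K p)"
  have I_eq: "I_CRMS ip M \<tau> = sqrt (1 / measure (M \<Otimes>\<^sub>M M) (off_diagonal M) * J)"
    unfolding I_CRMS_def J_def K_def ..
  \<comment> \<open>On the diagonal \<open>K\<close> is \<open>1\<close>.\<close>
  have J_eq: "J = (\<integral>p. K p \<partial>(M \<Otimes>\<^sub>M M)) - measure (M \<Otimes>\<^sub>M M) (diagonal M)"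
  proof -
    have "J = (\<integral>p. K p - indicator (diagonal M) p \<partial>(M \<Otimes>\<^sub>M M))"
      unfolding J_def set_lebesgue_integral_def
      by (intro Bochner_Integration.integral_cong refl)
        (auto simp: off indicator_def K_def diagonal_def unit H.ip_self)
    also have "\<dots> = (\<integral>p. K p \<partial>(M \<Otimes>\<^sub>M M)) - measure (M \<Otimes>\<^sub>M M) (diagonal M)"
      using K_int assms(5) by (simp add: less_top[symmetric])
    finally show ?thesis .
  qed
  have "J \<le> (\<integral>p. indicator (off_diagonal M) p \<partial>(M \<Otimes>\<^sub>M M))"
    unfolding J_def set_lebesgue_integral_def
  proof (rule integral_mono)
    show "integrable (M \<Otimes>\<^sub>M M) (indicator (off_diagonal M) :: _ \<Rightarrow> real)"
      using off_sets by (simp add: less_top[symmetric])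
    show "integrable (M \<Otimes>\<^sub>M M) (\<lambda>p. indicator (off_diagonal M) p *\<^sub>R K p)"
      by (intro integrable_mult_indicator off_sets K_int)
  qed (use K_le in \<open>auto simp: indicator_def\<close>)
  then have J_le: "J \<le> measure (M \<Otimes>\<^sub>M M) (off_diagonal M)"
    using off_sets by simp
  have "(measure M (space M))\<^sup>2 / real d \<le> (\<integral>p. K p \<partial>(M \<Otimes>\<^sub>M M))"
    using double_integral_gram_ge[OF M E(1) x_meas x_unit] by (simp add: K_eq d)
  then have "(measure M (space M))\<^sup>2 / real d - measure (M \<Otimes>\<^sub>M M) (diagonal M) \<le> J"
    by (simp add: J_eq)
  then have "I_CRMS ip M \<tau> \<ge>
      sqrt (1 / measure (M \<Otimes>\<^sub>M M) (off_diagonal M) *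
        ((measure M (space M))\<^sup>2 / real d - measure (M \<Otimes>\<^sub>M M) (diagonal M)))"
    unfolding I_eq by (intro real_sqrt_le_mono mult_left_mono) simp_all
  moreover have "1 / measure (M \<Otimes>\<^sub>M M) (off_diagonal M) * J \<le> 1"
    using J_le measure_nonneg[of "M \<Otimes>\<^sub>M M" "off_diagonal M"]
    \<comment> \<open>If the off-diagonal part is null, the factor \<open>1 / 0\<close> makes the product \<open>0\<close>.\<close>
    by (cases "measure (M \<Otimes>\<^sub>M M) (off_diagonal M) = 0") (simp_all add: divide_le_eq)
  then have "I_CRMS ip M \<tau> \<le> 1" unfolding I_eq by simp
  ultimately show ?thesis by blast
qed

end
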